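(* Let $N\ge 1$, let $x_0\in\mathbb{R}^n$, let $b_0\in\mathcal{B}$, and let the inputs be generated by policies, $u_k=\pi_k(\mathbf{o}_k,\mathbf{x}_k,x_0,b_0)$ for $k=0,\dots,N-1$, so that $x_{k+1}=Ax_k+Bu_k$. Then the expected cost can be equivalently written as $$\mathbb{E}_{\mathbf{o}_{N-1}}\Big[\sum_{k=0}^{N-1}h(x_k,u_k,e_k)+h_N(x_N,e_N)\,\Big|\,b_0\Big]=\sum_{k=0}^{N-1}\sum_{\mathbf{o}_k\in\mathcal{O}^k}\sum_{e\in\mathcal{E}}v_k^{\mathbf{o}_k}[e]\,h(x_k,u_k,e)+\sum_{\mathbf{o}_N\in\mathcal{O}^N}\sum_{e\in\mathcal{E}}v_N^{\mathbf{o}_N}[e]\,h_N(x_N,e),$$ where, on the right-hand side, $x_k$ and $u_k$ are the state and input at time $k$ generated along the observation sequence $\mathbf{o}_k$, and the unnormalized beliefs are defined by $v_0^{\mathbf{o}_0}=b_0$ and $v_k^{\mathbf{o}_k}=A_e(o_k,x_k)\,v_{k-1}^{\mathbf{o}_{k-1}}$ for $k\ge1$ (with $\mathbf{o}_{k-1}$ the prefix of $\mathbf{o}_k$).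
   Context: System: $x_{k+1}=Ax_k+Bu_k$ with $x_k\in\mathbb{R}^n$, $u_k\in\mathbb{R}^d$. Environment: a hidden Markov model $(\mathcal{E},\mathcal{O},T,Z)$ with finite state set $\mathcal{E}=\{1,\dots,|\mathcal{E}|\}$ and finite observation set $\mathcal{O}=\{1,\dots,|\mathcal{O}|\}$. The function $T:\mathcal{E}\times\mathcal{E}\times\mathbb{R}^n\to[0,1]$, $T(e',e,x)=\mathbb{P}(e'|e,x)$, is the probability of moving to $e'$ from environment state $e$ when the system state is $x$ (so $\sum_{e'}T(e',e,x)=1$). The function $Z:\mathcal{E}\times\mathcal{O}\times\mathbb{R}^n\to[0,1]$, $Z(e,o,x)=\mathbb{P}(o|e,x)$, is the probability of observing $o$ when the environment state is $e$ and the system state is $x$ (so $\sum_oZ(e,o,x)=1$). The initial environment state has distribution $b_0$: $\mathbb{P}(e_0=e)=b_0[e]$. For $k\ge1$, given the past and $x_k$, $e_k$ has law $T(\cdot,e_{k-1},x_k)$, and then $o_k$ has law $Z(e_k,\cdot,x_k)$. Beliefs: $\mathcal{B}=\{b\in\mathbb{R}^{|\mathcal{E}|}: b[e]\ge0,\ \sum_e b[e]=1\}$. Notation: $\mathbf{o}_k=[o_1,\dots,o_k]\in\mathcal{O}^k$ is the observation vector, $\mathbf{x}_k=[x_1,\dots,x_k]$ the state trajectory; $\mathcal{O}^0$ is a singleton whose only element is denoted $\mathbf{o}_0$ (no observation at time $0$). The policy $\pi_k$ maps $(\mathbf{o}_k,\mathbf{x}_k,x_0,b_0)$ to an input in $\mathbb{R}^d$.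 Since the dynamics are deterministic, $u_k$ is determined by $\mathbf{o}_k$ and $x_k$ by $\mathbf{o}_{k-1}$, given $x_0,b_0$. Costs: $h:\mathbb{R}^n\times\mathbb{R}^d\times\mathcal{E}\to\mathbb{R}$ and $h_N:\mathbb{R}^n\times\mathcal{E}\to\mathbb{R}$. The expectation is over the random observations and the environment states, given the initial state $x_0$ and belief $b_0$. Matrix: $A_e(o,x)=\Theta(o,x)\,\Omega(x)\in\mathbb{R}^{|\mathcal{E}|\times|\mathcal{E}|}$, where $\Omega(x)$ has $(i,j)$ entry $T(i,j,x)$ and $\Theta(o,x)=\mathrm{diag}(Z(1,o,x),\dots,Z(|\mathcal{E}|,o,x))$. *)

theory Defs
  imports "HOL-Probability.Probability"
begin

definition beliefs :: "(real ^ 'e::finite) set" where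
  "beliefs = {b. (\<forall>e. 0 \<le> b $ e) \<and> (\<Sum>e\<in>UNIV. b $ e) = 1}"

text \<open>Argument order: \<open>T e' e x\<close> is the probability of moving from \<open>e\<close> to \<open>e'\<close>,
  and \<open>Z e y x\<close> is the probability of observing \<open>y\<close> in environment state \<open>e\<close>.\<close>

definition hidden_markov_model ::
    "('e::finite \<Rightarrow> 'e \<Rightarrow> real ^ 'n::finite \<Rightarrow> real) \<Rightarrow>
     ('e \<Rightarrow> 'o::finite \<Rightarrow> real ^ 'n \<Rightarrow> real) \<Rightarrow> bool" where
  "hidden_markov_model T Z \<longleftrightarrow>
     (\<forall>e' e x. T e' e x \<in> {0..1}) \<and> (\<forall>e x. (\<Sum>e'\<in>UNIV. T e' e x) = 1) \<and>
     (\<forall>e y x. Z e y x \<in> {0..1}) \<and> (\<forall>e x. (\<Sum>y\<in>UNIV. Z e y x) = 1)"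

text \<open>Observation vectors are lists, so \<open>o\<^sub>i\<close> is \<open>os ! (i - 1)\<close>, and \<open>take k os\<close> is the vector of
  the first \<open>k\<close> observations. A policy receives the time \<open>k\<close>, the vectors
  \<open>[o\<^sub>1, \<dots>, o\<^sub>k]\<close> and \<open>[x\<^sub>1, \<dots>, x\<^sub>k]\<close>, and the initial state and belief.\<close>

type_synonym ('o, 'n, 'd, 'e) policy =
  "nat \<Rightarrow> 'o list \<Rightarrow> (real ^ 'n) list \<Rightarrow> real ^ 'n \<Rightarrow> real ^ 'e \<Rightarrow> real ^ 'd"

text \<open>\<open>state_at \<dots> os k\<close> and \<open>input_at \<dots> os k\<close> are \<open>x\<^sub>k\<close> and \<open>u\<^sub>k\<close> along \<open>os\<close>. The former depends
  only on the first \<open>k - 1\<close>, the latter only on the first \<open>k\<close> observations in \<open>os\<close>.\<close>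

fun state_at ::
    "real ^ 'n ^ 'n \<Rightarrow> real ^ 'd ^ 'n \<Rightarrow> ('o, 'n::finite, 'd::finite, 'e::finite) policy \<Rightarrow>
     real ^ 'n \<Rightarrow> real ^ 'e \<Rightarrow> 'o list \<Rightarrow> nat \<Rightarrow> real ^ 'n" where
  "state_at A B \<pi> x0 b0 os 0 = x0"
| "state_at A B \<pi> x0 b0 os (Suc k) =
     A *v state_at A B \<pi> x0 b0 os k +
     B *v \<pi> k (take k os) (map (\<lambda>i. state_at A B \<pi> x0 b0 os i) [1..<Suc k]) x0 b0"

definition input_at ::
    "real ^ 'n ^ 'n \<Rightarrow> real ^ 'd ^ 'n \<Rightarrow> ('o, 'n::finite, 'd::finite, 'e::finite) policy \<Rightarrow>
     real ^ 'n \<Rightarrow> real ^ 'e \<Rightarrow> 'o list \<Rightarrow> nat \<Rightarrow> real ^ 'd" where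
  "input_at A B \<pi> x0 b0 os k =
     \<pi> k (take k os) (map (\<lambda>i. state_at A B \<pi> x0 b0 os i) [1..<Suc k]) x0 b0"

lemma state_at_Suc:
  "state_at A B \<pi> x0 b0 os (Suc k) =
     A *v state_at A B \<pi> x0 b0 os k + B *v input_at A B \<pi> x0 b0 os k"
  by (simp add: input_at_def)

definition transition_matrix ::
    "('e::finite \<Rightarrow> 'e \<Rightarrow> real ^ 'n::finite \<Rightarrow> real) \<Rightarrow> real ^ 'n \<Rightarrow> real ^ 'e ^ 'e" where
  "transition_matrix T x = (\<chi> i j. T i j x)"

definition observation_matrix ::
    "('e::finite \<Rightarrow> 'o \<Rightarrow> real ^ 'n::finite \<Rightarrow> real) \<Rightarrow> 'o \<Rightarrow> real ^ 'n \<Rightarrow> real ^ 'e ^ 'e" where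
  "observation_matrix Z y x = (\<chi> i j. if i = j then Z i y x else 0)"

definition belief_update_matrix ::
    "('e::finite \<Rightarrow> 'e \<Rightarrow> real ^ 'n::finite \<Rightarrow> real) \<Rightarrow> ('e \<Rightarrow> 'o \<Rightarrow> real ^ 'n \<Rightarrow> real) \<Rightarrow>
     'o \<Rightarrow> real ^ 'n \<Rightarrow> real ^ 'e ^ 'e" where
  "belief_update_matrix T Z y x = observation_matrix Z y x ** transition_matrix T x"

text \<open>\<open>unnorm_belief \<dots> os k\<close> is \<open>v\<^sub>k\<close> for the first \<open>k\<close> observations in \<open>os\<close>; it is meaningful
  only for \<open>k \<le> length os\<close>.\<close>

primrec unnorm_belief ::
    "real ^ 'n ^ 'n \<Rightarrow> real ^ 'd ^ 'n \<Rightarrow> ('e \<Rightarrow> 'e \<Rightarrow> real ^ 'n \<Rightarrow> real) \<Rightarrow>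
     ('e \<Rightarrow> 'o \<Rightarrow> real ^ 'n \<Rightarrow> real) \<Rightarrow> ('o, 'n::finite, 'd::finite, 'e::finite) policy \<Rightarrow>
     real ^ 'n \<Rightarrow> real ^ 'e \<Rightarrow> 'o list \<Rightarrow> nat \<Rightarrow> real ^ 'e" where
  "unnorm_belief A B T Z \<pi> x0 b0 os 0 = b0"
| "unnorm_belief A B T Z \<pi> x0 b0 os (Suc k) =
     belief_update_matrix T Z (os ! k) (state_at A B \<pi> x0 b0 os (Suc k)) *v
     unnorm_belief A B T Z \<pi> x0 b0 os k"

definition env_hist :: "(nat \<Rightarrow> 'w \<Rightarrow> 'e) \<Rightarrow> nat \<Rightarrow> 'w \<Rightarrow> 'e list" where
  "env_hist Env k \<omega> = map (\<lambda>i. Env i \<omega>) [0..<Suc k]"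

definition obs_hist :: "(nat \<Rightarrow> 'w \<Rightarrow> 'o) \<Rightarrow> nat \<Rightarrow> 'w \<Rightarrow> 'o list" where
  "obs_hist Obs k \<omega> = map (\<lambda>i. Obs i \<omega>) [1..<Suc k]"

text \<open>A realization, on an arbitrary probability space and up to time \<open>N\<close>, of the environment
  and observation processes of the model in closed loop with the policy. The past conditioned
  on is the full history \<open>e\<^sub>0, \<dots>, e\<^sub>k, o\<^sub>1, \<dots>, o\<^sub>k\<close> (plus \<open>e\<^bsub>k+1\<^esub>\<close> for the observation
  law); \<open>x\<^bsub>k+1\<^esub>\<close> is a function of it. \<open>Obs 0\<close> is unconstrained: there is no
  observation at time 0.\<close>

locale closed_loop_process = prob_space M
  for M :: "'w measure" +
  fixes A :: "real ^ 'n::finite ^ 'n" and B :: "real ^ 'd::finite ^ 'n"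
    and T :: "'e::finite \<Rightarrow> 'e \<Rightarrow> real ^ 'n \<Rightarrow> real"
    and Z :: "'e \<Rightarrow> 'o::finite \<Rightarrow> real ^ 'n \<Rightarrow> real"
    and \<pi> :: "('o, 'n, 'd, 'e) policy"
    and x0 :: "real ^ 'n" and b0 :: "real ^ 'e" and N :: nat
    and Env :: "nat \<Rightarrow> 'w \<Rightarrow> 'e" and Obs :: "nat \<Rightarrow> 'w \<Rightarrow> 'o"
  assumes measurable_Env: "k \<le> N \<Longrightarrow> Env k \<in> measurable M (count_space UNIV)"
    and measurable_Obs: "1 \<le> k \<Longrightarrow> k \<le> N \<Longrightarrow> Obs k \<in> measurable M (count_space UNIV)"
    and law_initial: "\<P>(\<omega> in M. Env 0 \<omega> = e) = b0 $ e"
    and law_transition: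
      "k < N \<Longrightarrow> \<P>(\<omega> in M. env_hist Env k \<omega> = es \<and> obs_hist Obs k \<omega> = os) \<noteq> 0 \<Longrightarrow>
       \<P>(\<omega> in M. Env (Suc k) \<omega> = e' \<bar> env_hist Env k \<omega> = es \<and> obs_hist Obs k \<omega> = os) =
         T e' (last es) (state_at A B \<pi> x0 b0 os (Suc k))"
    and law_observation:
      "k < N \<Longrightarrow> \<P>(\<omega> in M. env_hist Env (Suc k) \<omega> = es \<and> obs_hist Obs k \<omega> = os) \<noteq> 0 \<Longrightarrow>
       \<P>(\<omega> in M. Obs (Suc k) \<omega> = y \<bar> env_hist Env (Suc k) \<omega> = es \<and> obs_hist Obs k \<omega> = os) =
         Z (last es) y (state_at A B \<pi> x0 b0 os (Suc k))"

end

theory Submission imports Defs begin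

text \<open>The unnormalized belief is the joint law \<open>v\<^sub>k[e] = \<P>(e\<^sub>k = e, \<^bold>o\<^sub>k)\<close>. Conditioning on the
  full history, the joint law of one more environment state and observation acquires the factors
  \<open>T\<close> and \<open>Z\<close>, and summing out the earlier environment states leaves one step of the linear
  recursion. Each stage cost is a function of \<open>(\<^bold>o\<^sub>k, e\<^sub>k)\<close>, which has finite range.\<close>

section \<open>Dependence on observation prefixes\<close>

text \<open>The input at time k reads the first k observations and the states up to time k, which
  see even fewer. The policy receives the whole state trajectory, so the induction has to be
  strong.\<close>

lemma state_at_cong:
  assumes "take k os = take k os'"
  shows "state_at A B \<pi> x0 b0 os (Suc k) = state_at A B \<pi> x0 b0 os' (Suc k)"
  using assms
proof (induction k rule: less_induct)
  case (less k)
  have "state_at A B \<pi> x0 b0 os j = state_at A B \<pi> x0 b0 os' j" if "j \<le> k" for j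
  proof (cases j)
    case (Suc i)
    \<comment> \<open>Here \<open>i < k\<close>, so shortening the common prefix gives the premise
      needed at \<open>i\<close>.\<close>
    have "take i (take k os) = take i (take k os')"
      using less.prems by simp
    then show ?thesis
      using less.IH[of i] that Suc by (simp add: min_def del: state_at.simps)
  qed simp
  then have "map (state_at A B \<pi> x0 b0 os) [1..<Suc k] = map (state_at A B \<pi> x0 b0 os') [1..<Suc k]"
    and "state_at A B \<pi> x0 b0 os k = state_at A B \<pi> x0 b0 os' k"
    by (simp_all del: state_at.simps upt_Suc)
  then show ?case
    by (simp only: state_at.simps less.prems)
qed

text \<open>v_k uses o_1, ..., o_k and states that see only earlier observations. This lets an
  induction over time discard the newest observation.\<close>

lemma unnorm_belief_append:
  assumes "k \<le> length os"
  shows "unnorm_belief A B T Z \<pi> x0 b0 (os @ os') k = unnorm_belief A B T Z \<pi> x0 b0 os k"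
  using assms
proof (induction k)
  case (Suc k)
  then have "state_at A B \<pi> x0 b0 (os @ os') (Suc k) = state_at A B \<pi> x0 b0 os (Suc k)"
    by (intro state_at_cong) simp
  then show ?case
    using Suc by (simp add: nth_append del: state_at.simps)
qed simp

text \<open>The diagonal factor only rescales rows, so the update is prediction by \<open>T\<close>
  followed by weighting with the likelihood of \<open>y\<close>.\<close>

lemma belief_update_matrix_mult:
  "(belief_update_matrix T Z y x *v b) $ e = Z e y x * (\<Sum>e'\<in>UNIV. T e e' x * b $ e')"
  by (simp add: belief_update_matrix_def observation_matrix_def transition_matrix_def
      matrix_vector_mult_def matrix_matrix_mult_def if_distrib[of "\<lambda>c. c * _"] sum_distrib_left
      mult.assoc cong: if_cong)

section \<open>Histories as random lists\<close>

lemma env_hist_Suc: "env_hist Env (Suc k) \<omega> = env_hist Env k \<omega> @ [Env (Suc k) \<omega>]"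
  by (simp add: env_hist_def)

lemma obs_hist_Suc: "obs_hist Obs (Suc k) \<omega> = obs_hist Obs k \<omega> @ [Obs (Suc k) \<omega>]"
  by (simp add: obs_hist_def)

lemma length_env_hist [simp]: "length (env_hist Env k \<omega>) = Suc k"
  by (simp add: env_hist_def)

lemma last_env_hist [simp]: "last (env_hist Env k \<omega>) = Env k \<omega>"
  by (simp add: env_hist_def)

lemma length_obs_hist [simp]: "length (obs_hist Obs k \<omega>) = k"
  by (simp add: obs_hist_def)

lemma finite_lists_of_length [simp]: "finite {xs :: 'a::finite list. length xs = n}"
  using finite_lists_length_eq[of "UNIV :: 'a set" n] by simp

text \<open>Lists over a countable type are countable, so discrete measurability survives each
  \<open>Cons\<close>.\<close>

lemma measurable_map_count_space:
  fixes X :: "'i \<Rightarrow> 'w \<Rightarrow> 'a::countable"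
  assumes "\<And>i. i \<in> set is \<Longrightarrow> X i \<in> measurable M (count_space UNIV)"
  shows "(\<lambda>\<omega>. map (\<lambda>i. X i \<omega>) is) \<in> measurable M (count_space UNIV)"
  using assms
proof (induction "is")
  case (Cons i "is")
  have [measurable]: "X i \<in> measurable M (count_space UNIV)"
    "(\<lambda>\<omega>. map (\<lambda>i. X i \<omega>) is) \<in> measurable M (count_space UNIV)"
    using Cons by auto
  show ?case
    by simp
qed simp

section \<open>Finite-valued random variables and conditioning\<close>

context prob_space
begin

text \<open>Law of total probability: the values of \<open>X\<close> cut the space into finitely
  many disjoint events.\<close>

lemma prob_eq_sum_prob:
  assumes [measurable]: "X \<in> measurable M (count_space UNIV)" "Measurable.pred M Q"
    and "finite S" "\<And>\<omega>. \<omega> \<in> space M \<Longrightarrow> X \<omega> \<in> S"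
  shows "\<P>(\<omega> in M. Q \<omega>) = (\<Sum>s\<in>S. \<P>(\<omega> in M. X \<omega> = s \<and> Q \<omega>))"
proof -
  have "{\<omega> \<in> space M. Q \<omega>} = (\<Union>s\<in>S. {\<omega> \<in> space M. X \<omega> = s \<and> Q \<omega>})"
    using assms by auto
  also have "prob \<dots> = (\<Sum>s\<in>S. \<P>(\<omega> in M. X \<omega> = s \<and> Q \<omega>))"
    using \<open>finite S\<close> by (intro finite_measure_finite_Union) (auto simp: disjoint_family_on_def)
  finally show ?thesis .
qed

text \<open>The integrand is a finite combination of indicators. \<open>has_bochner_integral\<close>
  carries integrability along with the value, so costs can later be added without a separate
  integrability argument.\<close>

lemma has_bochner_integral_finite_range:
  fixes f :: "'b \<Rightarrow> real"
  assumes [measurable]: "X \<in> measurable M (count_space UNIV)"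
    and "finite S" "\<And>\<omega>. \<omega> \<in> space M \<Longrightarrow> X \<omega> \<in> S"
  shows "has_bochner_integral M (\<lambda>\<omega>. f (X \<omega>)) (\<Sum>s\<in>S. \<P>(\<omega> in M. X \<omega> = s) * f s)"
proof -
  have "has_bochner_integral M
          (\<lambda>\<omega>. \<Sum>s\<in>S. indicat_real {\<omega> \<in> space M. X \<omega> = s} \<omega> * f s)
          (\<Sum>s\<in>S. \<P>(\<omega> in M. X \<omega> = s) * f s)"
    by (intro has_bochner_integral_sum has_bochner_integral_mult_left
        has_bochner_integral_real_indicator) (auto simp: emeasure_eq_measure)
  also have "?this \<longleftrightarrow> ?thesis"
  proof (rule has_bochner_integral_cong[OF refl _ refl])
    fix \<omega> assume "\<omega> \<in> space M"
    then have "(\<Sum>s\<in>S. indicat_real {\<omega> \<in> space M. X \<omega> = s} \<omega> * f s)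
        = (\<Sum>s\<in>S. if X \<omega> = s then f s else 0)"
      by (intro sum.cong) auto
    then show "(\<Sum>s\<in>S. indicat_real {\<omega> \<in> space M. X \<omega> = s} \<omega> * f s) = f (X \<omega>)"
      using \<open>\<omega> \<in> space M\<close> assms by simp
  qed
  finally show ?thesis .
qed

text \<open>Multiplication rule, guarded in the same way as the laws of
  \<open>closed_loop_process\<close>. If \<open>Q\<close> is null, monotonicity makes both sides
  zero whatever \<open>c\<close> is.\<close>

lemma prob_conj_eq_mult:
  assumes "Measurable.pred M P" "Measurable.pred M Q"
    and "\<P>(\<omega> in M. Q \<omega>) \<noteq> 0 \<Longrightarrow> \<P>(\<omega> in M. P \<omega> \<bar> Q \<omega>) = c"
  shows "\<P>(\<omega> in M. P \<omega> \<and> Q \<omega>) = c * \<P>(\<omega> in M. Q \<omega>)"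
proof (cases "\<P>(\<omega> in M. Q \<omega>) = 0")
  case True
  have "\<P>(\<omega> in M. P \<omega> \<and> Q \<omega>) \<le> \<P>(\<omega> in M. Q \<omega>)"
    using assms(1,2) by (intro finite_measure_mono) auto
  with True show ?thesis
    by (simp add: measure_le_0_iff)
next
  case False
  with assms(3) show ?thesis
    by (auto simp: cond_prob_def field_simps)
qed

end

section \<open>Joint law of histories and the beliefs\<close>

context closed_loop_process
begin

lemma measurable_env_hist:
  "k \<le> N \<Longrightarrow> env_hist Env k \<in> measurable M (count_space UNIV)"
  unfolding env_hist_def[abs_def]
  by (intro measurable_map_count_space measurable_Env) auto

lemma measurable_obs_hist:
  "k \<le> N \<Longrightarrow> obs_hist Obs k \<in> measurable M (count_space UNIV)"
  unfolding obs_hist_def[abs_def]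
  by (intro measurable_map_count_space measurable_Obs) auto

text \<open>Chain rule in the order of the draws: first e_(k+1), then o_(k+1) given it. Both kernels
  see the same state, since x_(k+1) is a function of \<open>os\<close>. Lists of the wrong length
  make both sides zero.\<close>

lemma prob_history_step:
  assumes "k < N"
  defines "x \<equiv> \<lambda>os. state_at A B \<pi> x0 b0 os (Suc k)"
  shows "\<P>(\<omega> in M. env_hist Env (Suc k) \<omega> = es @ [e] \<and> obs_hist Obs (Suc k) \<omega> = os @ [y]) =
    Z e y (x os) * (T e (last es) (x os) * \<P>(\<omega> in M. env_hist Env k \<omega> = es \<and> obs_hist Obs k \<omega> = os))"
proof -
  have [measurable]: "Env (Suc k) \<in> measurable M (count_space UNIV)"
    "Obs (Suc k) \<in> measurable M (count_space UNIV)"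
    "env_hist Env k \<in> measurable M (count_space UNIV)"
    "env_hist Env (Suc k) \<in> measurable M (count_space UNIV)"
    "obs_hist Obs k \<in> measurable M (count_space UNIV)"
    using \<open>k < N\<close>
    by (auto intro: measurable_Env measurable_Obs measurable_env_hist measurable_obs_hist)
  have "\<P>(\<omega> in M. env_hist Env (Suc k) \<omega> = es @ [e] \<and> obs_hist Obs (Suc k) \<omega> = os @ [y]) =
      \<P>(\<omega> in M. Obs (Suc k) \<omega> = y \<and> env_hist Env (Suc k) \<omega> = es @ [e] \<and> obs_hist Obs k \<omega> = os)"
    by (intro arg_cong[where f = prob]) (auto simp: obs_hist_Suc)
  \<comment> \<open>The conditioning history ends in \<open>e\<close>, so the observation law yields
    \<open>Z e y\<close>.\<close>
  also have "\<dots> = Z e y (x os) *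
      \<P>(\<omega> in M. env_hist Env (Suc k) \<omega> = es @ [e] \<and> obs_hist Obs k \<omega> = os)"
    using law_observation[OF \<open>k < N\<close>, of "es @ [e]"] unfolding x_def
    by (intro prob_conj_eq_mult) auto
  also have "\<P>(\<omega> in M. env_hist Env (Suc k) \<omega> = es @ [e] \<and> obs_hist Obs k \<omega> = os) =
      \<P>(\<omega> in M. Env (Suc k) \<omega> = e \<and> env_hist Env k \<omega> = es \<and> obs_hist Obs k \<omega> = os)"
    by (intro arg_cong[where f = prob]) (auto simp: env_hist_Suc)
  also have "\<dots> = T e (last es) (x os) *
      \<P>(\<omega> in M. env_hist Env k \<omega> = es \<and> obs_hist Obs k \<omega> = os)"
    using law_transition[OF \<open>k < N\<close>] unfolding x_def
    by (intro prob_conj_eq_mult) auto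
  finally show ?thesis .
qed

text \<open>This is the forward recursion of hidden Markov models. The laws condition on full
  histories rather than on the current environment state, so the step expands the event over all
  environment histories and regroups them by last entry. It needs the preceding belief at every e',
  hence the generalization over \<open>os\<close> and \<open>e\<close>.\<close>

lemma unnorm_belief_eq_prob:
  assumes "k \<le> N" "length os = k"
  shows "unnorm_belief A B T Z \<pi> x0 b0 os k $ e =
    \<P>(\<omega> in M. obs_hist Obs k \<omega> = os \<and> Env k \<omega> = e)"
  using assms
proof (induction k arbitrary: os e)
  case 0
  then show ?case
    using law_initial[of e] by (simp add: obs_hist_def)
next
  case (Suc k)
  then obtain os' y where os: "os = os' @ [y]" and len: "length os' = k"
    by (metis length_Suc_conv_rev)
  have "k < N"
    using Suc.prems by simp
  define x where "x = state_at A B \<pi> x0 b0 os' (Suc k)"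
  \<comment> \<open>Histories e_0, ..., e_k have k + 1 entries.\<close>
  define L where "L = {es :: 'e list. length es = Suc k}"
  define p where "p es = \<P>(\<omega> in M. env_hist Env k \<omega> = es \<and> obs_hist Obs k \<omega> = os')" for es
  have [measurable]: "Env k \<in> measurable M (count_space UNIV)"
    "Env (Suc k) \<in> measurable M (count_space UNIV)"
    "env_hist Env k \<in> measurable M (count_space UNIV)"
    "obs_hist Obs k \<in> measurable M (count_space UNIV)"
    "obs_hist Obs (Suc k) \<in> measurable M (count_space UNIV)"
    using \<open>k < N\<close> by (auto intro: measurable_Env measurable_env_hist measurable_obs_hist)
  \<comment> \<open>The newest observation \<open>y\<close> cannot influence x_(k+1).\<close>
  have x: "state_at A B \<pi> x0 b0 os (Suc k) = x"
    unfolding x_def os using len by (intro state_at_cong) simp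
  \<comment> \<open>The induction hypothesis, refined over environment histories: once
    \<open>es\<close> is fixed, the condition on e_k holds automatically or is impossible.\<close>
  have marginal: "unnorm_belief A B T Z \<pi> x0 b0 os k $ e' = (\<Sum>es\<in>L. if last es = e' then p es else 0)"
    for e'
  proof -
    have "unnorm_belief A B T Z \<pi> x0 b0 os k $ e' =
        \<P>(\<omega> in M. obs_hist Obs k \<omega> = os' \<and> Env k \<omega> = e')"
      using Suc.IH[of os' e'] \<open>k < N\<close> len by (simp add: os unnorm_belief_append)
    also have "\<dots> = (\<Sum>es\<in>L. \<P>(\<omega> in M. env_hist Env k \<omega> = es \<and> obs_hist Obs k \<omega> = os' \<and> Env k \<omega> = e'))"
      by (intro prob_eq_sum_prob) (auto simp: L_def)
    also have "\<dots> = (\<Sum>es\<in>L. if last es = e' then p es else 0)"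
      unfolding p_def
    proof (intro sum.cong refl)
      fix es
      show "\<P>(\<omega> in M. env_hist Env k \<omega> = es \<and> obs_hist Obs k \<omega> = os' \<and> Env k \<omega> = e') =
          (if last es = e' then \<P>(\<omega> in M. env_hist Env k \<omega> = es \<and> obs_hist Obs k \<omega> = os') else 0)"
      proof (cases "last es = e'")
        case True
        then show ?thesis
          by (auto intro!: arg_cong[where f = prob])
      next
        case False
        then have "{\<omega> \<in> space M. env_hist Env k \<omega> = es \<and> obs_hist Obs k \<omega> = os' \<and> Env k \<omega> = e'} = {}"
          by auto
        with False show ?thesis
          by (simp only: measure_empty if_False)
      qed
    qed
    finally show ?thesis .
  qed
  have "\<P>(\<omega> in M. obs_hist Obs (Suc k) \<omega> = os \<and> Env (Suc k) \<omega> = e) =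
      (\<Sum>es\<in>L. \<P>(\<omega> in M. env_hist Env k \<omega> = es \<and> obs_hist Obs (Suc k) \<omega> = os \<and> Env (Suc k) \<omega> = e))"
    by (intro prob_eq_sum_prob) (auto simp: L_def)
  also have "\<dots> = (\<Sum>es\<in>L. Z e y x * (T e (last es) x * p es))"
  proof (intro sum.cong refl)
    fix es
    have "\<P>(\<omega> in M. env_hist Env k \<omega> = es \<and> obs_hist Obs (Suc k) \<omega> = os \<and> Env (Suc k) \<omega> = e) =
        \<P>(\<omega> in M. env_hist Env (Suc k) \<omega> = es @ [e] \<and> obs_hist Obs (Suc k) \<omega> = os' @ [y])"
      by (intro arg_cong[where f = prob]) (auto simp: env_hist_Suc os)
    then show "\<P>(\<omega> in M. env_hist Env k \<omega> = es \<and> obs_hist Obs (Suc k) \<omega> = os \<and> Env (Suc k) \<omega> = e) =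
        Z e y x * (T e (last es) x * p es)"
      unfolding prob_history_step[OF \<open>k < N\<close>] x_def p_def .
  qed
  \<comment> \<open>Exactly one e' equals \<open>last es\<close>; inserting this trivial sum allows
    the histories to be grouped by final state.\<close>
  also have "\<dots> = Z e y x * (\<Sum>es\<in>L. \<Sum>e'\<in>UNIV. if last es = e' then T e e' x * p es else 0)"
    by (simp add: sum_distrib_left)
  also have "\<dots> = Z e y x * (\<Sum>e'\<in>UNIV. T e e' x * (\<Sum>es\<in>L. if last es = e' then p es else 0))"
    by (subst sum.swap)
      (simp add: sum_distrib_left if_distrib[of "\<lambda>c. _ * c"] cong: if_cong)
  \<comment> \<open>Lists are indexed from 0, so entry \<open>k\<close> of \<open>os\<close> is the
    newest observation \<open>y\<close>.\<close>
  also have "\<dots> = unnorm_belief A B T Z \<pi> x0 b0 os (Suc k) $ e"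
    using nth_append_length[of os' y "[]"] len
    by (simp add: belief_update_matrix_mult x marginal flip: os del: state_at.simps)
  finally show ?case ..
qed

text \<open>States and inputs are functions of the observation vector, so \<open>g\<close> can
  absorb them; running and terminal costs are both instances. The expectation becomes a finite sum
  against the joint law of observation vector and environment state, which is v_k.\<close>

lemma has_bochner_integral_stage_cost:
  fixes g :: "'o list \<Rightarrow> 'e \<Rightarrow> real"
  assumes "k \<le> N"
  shows "has_bochner_integral M (\<lambda>\<omega>. g (obs_hist Obs k \<omega>) (Env k \<omega>))
    (\<Sum>os | length os = k. \<Sum>e\<in>UNIV. unnorm_belief A B T Z \<pi> x0 b0 os k $ e * g os e)"
proof -
  define S where "S = {os :: 'o list. length os = k} \<times> (UNIV :: 'e set)"
  have [measurable]: "Env k \<in> measurable M (count_space UNIV)"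
    "obs_hist Obs k \<in> measurable M (count_space UNIV)"
    using assms by (auto intro: measurable_Env measurable_obs_hist)
  have "has_bochner_integral M (\<lambda>\<omega>. case_prod g (obs_hist Obs k \<omega>, Env k \<omega>))
      (\<Sum>s\<in>S. \<P>(\<omega> in M. (obs_hist Obs k \<omega>, Env k \<omega>) = s) * case_prod g s)"
    by (intro has_bochner_integral_finite_range) (auto simp: S_def)
  also have "(\<Sum>s\<in>S. \<P>(\<omega> in M. (obs_hist Obs k \<omega>, Env k \<omega>) = s) * case_prod g s) =
      (\<Sum>os | length os = k. \<Sum>e\<in>UNIV. unnorm_belief A B T Z \<pi> x0 b0 os k $ e * g os e)"
    unfolding S_def sum.cartesian_product
    using assms by (intro sum.cong) (auto simp: unnorm_belief_eq_prob)
  finally show ?thesis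
    by simp
qed

end

theorem proposition1:
  fixes A :: "real ^ 'n::finite ^ 'n" and B :: "real ^ 'd::finite ^ 'n"
    and T :: "'e::finite \<Rightarrow> 'e \<Rightarrow> real ^ 'n \<Rightarrow> real"
    and Z :: "'e \<Rightarrow> 'o::finite \<Rightarrow> real ^ 'n \<Rightarrow> real"
    and \<pi> :: "('o, 'n, 'd, 'e) policy"
    and h :: "real ^ 'n \<Rightarrow> real ^ 'd \<Rightarrow> 'e \<Rightarrow> real" and h\<^sub>N :: "real ^ 'n \<Rightarrow> 'e \<Rightarrow> real"
    and x0 :: "real ^ 'n" and b0 :: "real ^ 'e" and N :: nat
    and M :: "'w measure" and Env :: "nat \<Rightarrow> 'w \<Rightarrow> 'e" and Obs :: "nat \<Rightarrow> 'w \<Rightarrow> 'o"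
  defines "x \<equiv> state_at A B \<pi> x0 b0"
    and "u \<equiv> input_at A B \<pi> x0 b0"
    and "v \<equiv> unnorm_belief A B T Z \<pi> x0 b0"
  assumes "N \<ge> 1"
    and "b0 \<in> beliefs"
    and "hidden_markov_model T Z"
    and "closed_loop_process M A B T Z \<pi> x0 b0 N Env Obs"
  shows "prob_space.expectation M (\<lambda>\<omega>.
           (\<Sum>k<N. h (x (obs_hist Obs k \<omega>) k) (u (obs_hist Obs k \<omega>) k) (Env k \<omega>)) +
           h\<^sub>N (x (obs_hist Obs N \<omega>) N) (Env N \<omega>)) =
         (\<Sum>k<N. \<Sum>os | length os = k. \<Sum>e\<in>UNIV. v os k $ e * h (x os k) (u os k) e) +
         (\<Sum>os | length os = N. \<Sum>e\<in>UNIV. v os N $ e * h\<^sub>N (x os N) e)"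
proof -
  interpret closed_loop_process M A B T Z \<pi> x0 b0 N Env Obs
    by fact
  show ?thesis
    \<comment> \<open>Linearity splits the cost into stages; \<open>k < N\<close> and the terminal
      time both meet the bound \<open>k \<le> N\<close>.\<close>
    unfolding x_def u_def v_def
    by (intro has_bochner_integral_integral_eq has_bochner_integral_add has_bochner_integral_sum
        has_bochner_integral_stage_cost) auto
qed

end
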